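(* There is no proper holomorphic mapping from $\mathbb C\times\mathbb C$ to $\mathbb C\times\mathbb C_*$, none from $\mathbb C\times\mathbb C$ to $\mathbb C_*\times\mathbb C_*$, and none from $\mathbb C\times\mathbb C_*$ to $\mathbb C_*\times\mathbb C_*$.
   Context: $\mathbb C_*=\mathbb C\setminus\{0\}$. *)

theory Defs
  imports "HOL-Complex_Analysis.Complex_Analysis"
begin

abbreviation Cstar :: "complex set"
  where "Cstar \<equiv> - {0}"

text \<open>
  Holomorphic maps in two complex variables, meant for open domains \<open>U\<close>. The type
  \<open>complex \<times> complex\<close> only carries the structure of a real vector space, so that
  complex homogeneity of the (real-linear) derivative has to be required explicitly.
\<close>

definition holomorphic2_on ::
    "(complex \<times> complex \<Rightarrow> complex \<times> complex) \<Rightarrow> (complex \<times> complex) set \<Rightarrow> bool"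
    (infixl "(holomorphic2'_on)" 50) where
  "f holomorphic2_on U \<longleftrightarrow>
     (\<forall>z\<in>U. \<exists>D. (f has_derivative D) (at z within U) \<and>
        (\<forall>c v w. D (c * v, c * w) = (c * fst (D (v, w)), c * snd (D (v, w)))))"

definition proper_holomorphic ::
    "(complex \<times> complex) set \<Rightarrow> (complex \<times> complex) set \<Rightarrow>
     (complex \<times> complex \<Rightarrow> complex \<times> complex) \<Rightarrow> bool" where
  "proper_holomorphic U V f \<longleftrightarrow>
     f \<in> U \<rightarrow> V \<and> f holomorphic2_on U \<and> proper_map (top_of_set U) (top_of_set V) f"

lemma holomorphic2_on_imp_continuous_on:
  assumes "f holomorphic2_on U"
  shows "continuous_on U f"
  using assms unfolding holomorphic2_on_def continuous_on_eq_continuous_within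
  by (blast intro: has_derivative_continuous)

text \<open>
  The library calls a map proper if it is closed with compact fibres. For the maps
  considered here, this is the usual condition that preimages of compact sets are compact.
\<close>

lemma proper_holomorphic_iff:
  "proper_holomorphic U V f \<longleftrightarrow>
     f \<in> U \<rightarrow> V \<and> f holomorphic2_on U \<and>
     (\<forall>K. compact K \<and> K \<subseteq> V \<longrightarrow> compact {z \<in> U. f z \<in> K})"
proof (cases "f \<in> U \<rightarrow> V \<and> f holomorphic2_on U")
  case True
  have metr: "metrizable_space (top_of_set V)"
    by (simp add: metrizable_space_euclidean metrizable_space_subtopology)
  have k: "k_space (top_of_set V)"
    by (simp add: metr metrizable_imp_k_space)
  have kc: "kc_space (top_of_set V)"
    by (simp add: metr metrizable_imp_Hausdorff_space Hausdorff_imp_kc_space)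
  have cont: "continuous_map (top_of_set U) (top_of_set V) f"
    using True holomorphic2_on_imp_continuous_on by simp
  show ?thesis
    using True proper_eq_compact_map[OF k kc disjI1[OF cont]]
    by (auto simp: proper_holomorphic_def compactin_subtopology)
qed (auto simp: proper_holomorphic_def)

end

theory Submission
  imports Defs
begin

text \<open>
  In each of the three cases the map \<open>f\<close> yields a function \<open>g\<close> and a function \<open>q\<close> on the source such
  that \<open>f\<close> sees \<open>q\<close> only through \<open>exp q\<close>: for the source \<open>UNIV \<times> UNIV\<close>, \<open>g\<close> is the first component
  and \<open>q\<close> a logarithm of the second one, which omits 0. On \<open>UNIV \<times> Cstar\<close> the components have
  winding numbers around the puncture, but a suitable monomial in them has none and so is an
  \<open>exp q\<close>, and \<open>g\<close> is one of the components. Properness of \<open>f\<close> then says that on each level set \<open>X\<close> of \<open>g\<close> the part where \<open>Re q\<close> is bounded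
  is compact.

  This is impossible for a nonempty \<open>X\<close>. Heuristically, \<open>q\<close> is an open map on the curve \<open>X\<close>, but on
  the compact set of points of \<open>X\<close> where \<open>Re q\<close> has a given value, \<open>Im q\<close> attains a maximum. To
  avoid any structure theory of the curve, which may be singular, the argument is phrased as
  follows (\<open>level_set_empty\<close>). The image of \<open>X\<close> under \<open>q\<close> is closed and not the whole plane, so a disc
  touches it from outside in exactly one point \<open>s\<close>. A maximum principle for curves
  (\<open>zeros_with_extremal_value_persist\<close>) shows that the points of \<open>X\<close> over \<open>s\<close> project to an open set
  in the first coordinate. As they form a compact set, this is absurd. The maximum
  principle in turn is that of one variable, applied to the sum of a function over the zeros
  of \<open>g\<close> on vertical lines, which \<open>argument_principle_circle\<close> makes holomorphic.
\<close>

section \<open>Cauchy integrals with parameters\<close>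

text \<open>
  Locally the derivative is an integral of \<open>F\<close> itself, over a fixed circle and against a smooth
  kernel (Cauchy's formula), so it inherits the joint continuity of \<open>F\<close>.
\<close>

lemma continuous_on_deriv_param:
  fixes F :: "complex \<times> 'a::t2_space \<Rightarrow> complex"
  assumes A: "open A" and cont: "continuous_on (A \<times> T) F"
    and hol: "\<And>t. t \<in> T \<Longrightarrow> (\<lambda>z. F (z, t)) holomorphic_on A"
  shows "continuous_on (A \<times> T) (\<lambda>(z, t). deriv (\<lambda>z. F (z, t)) z)"
  unfolding continuous_on_eq_continuous_within
proof (intro ballI)
  fix x assume "x \<in> A \<times> T"
  then obtain c t where x: "x = (c, t)" "c \<in> A" "t \<in> T" by auto
  obtain r where r: "r > 0" "cball c r \<subseteq> A"
    using A x open_contains_cball by blast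
  let ?p = "circlepath c r"
  let ?D = "\<lambda>y. 1 / (2 * of_real pi * \<i>) * integral (cbox 0 (1::real))
      (\<lambda>s. F (?p s, snd y) / (?p s - fst y)^2 * (2 * pi * \<i> * r * exp (2 * of_real pi * \<i> * s)))"
  have p: "?p s \<in> sphere c r" if "s \<in> {0..1}" for s
    using r that path_image_circlepath_nonneg[of r c] by (auto simp: path_image_def)
  have ne: "?p s - fst y \<noteq> 0" if "s \<in> {0..1}" "y \<in> ball c r \<times> T" for s y
    using p[OF that(1)] that(2) by (auto simp: dist_norm mem_Times_iff)
  have contp: "continuous_on UNIV ?p"
    unfolding circlepath_def part_circlepath_def linepath_def by (intro continuous_intros)
  have cF: "continuous_on ((ball c r \<times> T) \<times> cbox 0 1) (\<lambda>u. F (?p (snd u), snd (fst u)))"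
    by (rule continuous_on_compose2[OF cont])
       (use p r in \<open>force intro!: continuous_intros continuous_on_compose2[OF contp]\<close>)+
  have "continuous_on (ball c r \<times> T) ?D"
    apply (intro continuous_on_mult continuous_on_const integral_continuous_on_param)
    unfolding case_prod_beta
    apply (intro continuous_on_mult continuous_on_divide cF continuous_on_power continuous_on_diff
        continuous_on_compose2[OF contp] continuous_on_exp continuous_on_of_real continuous_intros)
    using ne by (auto simp: mem_Times_iff)
  moreover have "?D y = (\<lambda>(z, t). deriv (\<lambda>z. F (z, t)) z) y" if y: "y \<in> ball c r \<times> T" for y
  proof -
    obtain z s where zs: "y = (z, s)" "z \<in> ball c r" "s \<in> T" using y by auto
    have h: "(\<lambda>z. F (z, s)) holomorphic_on A" using hol zs by blast
    have "((\<lambda>z. F (z, s)) has_field_derivative (1 / (2 * of_real pi * \<i>) *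
        contour_integral ?p (\<lambda>u. F (u, s) / (u - z)^2))) (at z)"
      using holomorphic_on_subset[OF h, of "cball c r"] holomorphic_on_subset[OF h, of "ball c r"]
        r zs ball_subset_cball[of c r]
      by (intro Cauchy_derivative_integral_circlepath) (auto intro: holomorphic_on_imp_continuous_on)
    from DERIV_imp_deriv[OF this] show ?thesis
      by (simp add: zs contour_integral_integral vector_derivative_circlepath)
  qed
  ultimately have "continuous_on (ball c r \<times> T) (\<lambda>(z, t). deriv (\<lambda>z. F (z, t)) z)"
    using continuous_on_eq by blast
  then have "continuous (at x within ball c r \<times> T) (\<lambda>(z, t). deriv (\<lambda>z. F (z, t)) z)"
    using x r by (auto simp: continuous_on_eq_continuous_within)
  moreover have "at x within ball c r \<times> T = at x within A \<times> T"
    by (rule at_within_nhd[of _ "ball c r \<times> UNIV"])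
       (use x r in \<open>auto simp: open_Times\<close>)
  ultimately show "continuous (at x within A \<times> T) (\<lambda>(z, t). deriv (\<lambda>z. F (z, t)) z)"
    by simp
qed

lemma holomorphic_circle_integral_param:
  assumes A: "open A" "convex A" and r: "r > 0"
    and cont: "continuous_on (A \<times> sphere c r) F"
    and hol: "\<And>w. w \<in> sphere c r \<Longrightarrow> (\<lambda>z. F (z, w)) holomorphic_on A"
  shows "(\<lambda>z. contour_integral (circlepath c r) (\<lambda>w. F (z, w))) holomorphic_on A"
proof -
  let ?p = "circlepath c r"
  let ?v = "\<lambda>s::real. 2 * pi * \<i> * r * exp (2 * of_real pi * \<i> * s)"
  have p: "?p s \<in> sphere c r" if "s \<in> {0..1}" for s
    using r that path_image_circlepath_nonneg[of r c] by (auto simp: path_image_def)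
  have contp: "continuous_on UNIV ?p"
    unfolding circlepath_def part_circlepath_def linepath_def by (intro continuous_intros)
  define G where "G = (\<lambda>(z, s). F (z, ?p s) * ?v s)"
  have contG: "continuous_on (A \<times> {0..1}) G"
    unfolding G_def case_prod_beta
    by (intro continuous_intros continuous_on_compose2[OF cont])
       (use p in \<open>auto intro!: continuous_intros continuous_on_compose2[OF contp]\<close>)
  have holG: "(\<lambda>z. G (z, s)) holomorphic_on A" if "s \<in> {0..1}" for s
    unfolding G_def using hol p[OF that] by (auto intro!: holomorphic_intros)
  have "(\<lambda>z. integral (cbox 0 1) (\<lambda>s. G (z, s))) holomorphic_on A"
  proof (rule leibniz_rule_holomorphic[where fx = "\<lambda>z s. deriv (\<lambda>z. G (z, s)) z"])
    show "((\<lambda>x. G (x, t)) has_field_derivative deriv (\<lambda>z. G (z, t)) x) (at x within A)"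
      if "x \<in> A" "t \<in> cbox 0 1" for x t
      using holG[of t] that A by (auto intro: holomorphic_derivI)
    show "(\<lambda>s. G (x, s)) integrable_on cbox 0 1" if "x \<in> A" for x
      by (intro integrable_continuous continuous_on_compose2[OF contG])
         (use that in \<open>auto intro!: continuous_intros\<close>)
    show "continuous_on (A \<times> cbox 0 1) (\<lambda>(x, t). deriv (\<lambda>z. G (z, t)) x)"
      using continuous_on_deriv_param[OF A(1) contG holG] by simp
  qed (fact A)
  then show ?thesis
    by (simp add: contour_integral_integral vector_derivative_circlepath G_def)
qed

text \<open>
  The residue theorem turns a sum over the zeros of \<open>f\<close>, weighted by their order and by \<open>h\<close>,
  into an integral over a fixed circle. The integral can be followed when \<open>f\<close> moves with a
  parameter, the single zeros cannot. The factor 3 leaves a margin: the zeros in the disc of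
  radius \<open>2 * r\<close> are finitely many, because its closure is a compact part of the domain.
\<close>

lemma argument_principle_circle:
  assumes r: "0 < r" and f: "f holomorphic_on ball c (3*r)" and h: "h holomorphic_on ball c (3*r)"
    and nz: "\<And>w. w \<in> sphere c r \<Longrightarrow> f w \<noteq> 0"
  defines "Z \<equiv> {w \<in> ball c r. f w = 0}"
  shows "finite Z" "\<And>w. w \<in> Z \<Longrightarrow> zorder f w > 0"
    "contour_integral (circlepath c r) (\<lambda>w. deriv f w * h w / f w) =
       2 * pi * \<i> * (\<Sum>w\<in>Z. h w * of_int (zorder f w))"
proof -
  define P where "P = {w \<in> ball c (2*r). f w = 0}"
  have 1: "c + of_real r \<in> sphere c r" using r by (auto simp: dist_norm)
  have nc: "\<exists>w\<in>ball c (3*r). f w \<noteq> 0"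
    using nz[OF 1] r by (intro bexI[of _ "c + of_real r"]) (auto simp: dist_norm)
  have "finite {w \<in> cball c (2*r). f w = 0}"
  proof (cases "\<exists>w\<in>ball c (3*r). f w = 0")
    case True
    then have "\<not> f constant_on ball c (3*r)"
      using nc unfolding constant_on_def by force
    then show ?thesis
      using r by (intro holomorphic_compact_finite_zeros[OF f]) auto
  next
    case False
    moreover have "cball c (2*r) \<subseteq> ball c (3*r)" using r by auto
    ultimately have "{w \<in> cball c (2*r). f w = 0} = {}" by blast
    then show ?thesis by (simp only: finite.emptyI)
  qed
  then have finP: "finite P" by (rule finite_subset[rotated]) (auto simp: P_def)
  show finZ: "finite Z" using finP by (rule finite_subset[rotated]) (use r in \<open>auto simp: P_def Z_def\<close>)
  show "zorder f w > 0" if "w \<in> Z" for w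
    using zorder_exist_zero[OF f _ _ _ nc, of w] that r by (auto simp: Z_def split: if_splits)
  have "contour_integral (circlepath c r) (\<lambda>w. deriv f w * h w / f w) =
      2 * pi * \<i> * (\<Sum>w\<in>{w \<in> ball c (2*r). f w = 0 \<or> w \<in> {}}. winding_number (circlepath c r) w * h w * of_int (zorder f w))"
    apply (rule argument_principle)
    using f h r nz finP apply (auto simp: P_def intro: holomorphic_on_subset)
    apply (rule winding_number_zero_outside[of _ "cball c r"])
    apply auto
    done
  also have "(\<Sum>w\<in>{w \<in> ball c (2*r). f w = 0 \<or> w \<in> {}}. winding_number (circlepath c r) w * h w * of_int (zorder f w))
     = (\<Sum>w\<in>Z. winding_number (circlepath c r) w * h w * of_int (zorder f w))"
  proof (rule sum.mono_neutral_right)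
    show "\<forall>i\<in>{w \<in> ball c (2 * r). f w = 0 \<or> w \<in> {}} - Z. winding_number (circlepath c r) i * h i * of_int (zorder f i) = 0"
    proof
      fix w assume w: "w \<in> {w \<in> ball c (2 * r). f w = 0 \<or> w \<in> {}} - Z"
      with nz have "w \<notin> cball c r" by (auto simp: Z_def)
      then have "winding_number (circlepath c r) w = 0"
        by (intro winding_number_zero_outside[of _ "cball c r"]) (use r in auto)
      then show "winding_number (circlepath c r) w * h w * of_int (zorder f w) = 0" by simp
    qed
  qed (use finP r in \<open>auto simp: Z_def P_def\<close>)
  also have "\<dots> = (\<Sum>w\<in>Z. h w * of_int (zorder f w))"
    by (rule sum.cong) (auto simp: Z_def winding_number_circlepath dist_norm norm_minus_commute)
  finally show "contour_integral (circlepath c r) (\<lambda>w. deriv f w * h w / f w) =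
       2 * pi * \<i> * (\<Sum>w\<in>Z. h w * of_int (zorder f w))" .
qed

section \<open>A maximum principle on the zero set of a function of two variables\<close>

text \<open>
  Joint continuity follows from holomorphy in each variable by a deep theorem (Hartogs), and it
  is evident for the functions considered here; therefore it is part of the definition.
\<close>

definition separately_holomorphic_on ::
    "(complex \<times> complex \<Rightarrow> complex) \<Rightarrow> complex set \<Rightarrow> complex set \<Rightarrow> bool" where
  "separately_holomorphic_on g A D \<longleftrightarrow> continuous_on (A \<times> D) g \<and>
     (\<forall>w\<in>D. (\<lambda>z. g (z, w)) holomorphic_on A) \<and> (\<forall>z\<in>A. (\<lambda>w. g (z, w)) holomorphic_on D)"

lemma separately_holomorphic_onD:
  assumes "separately_holomorphic_on g A D"
  shows "continuous_on (A \<times> D) g"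
    "w \<in> D \<Longrightarrow> (\<lambda>z. g (z, w)) holomorphic_on A"
    "z \<in> A \<Longrightarrow> (\<lambda>w. g (z, w)) holomorphic_on D"
  using assms by (auto simp: separately_holomorphic_on_def)

lemma separately_holomorphic_on_subset:
  assumes "separately_holomorphic_on g A D" "A' \<subseteq> A" "D' \<subseteq> D"
  shows "separately_holomorphic_on g A' D'"
  using assms unfolding separately_holomorphic_on_def
  by (meson Sigma_mono continuous_on_subset holomorphic_on_subset subsetD)

lemma separately_holomorphic_on_compose:
  assumes g: "separately_holomorphic_on g A D" and h: "h holomorphic_on B" "g ` (A \<times> D) \<subseteq> B"
  shows "separately_holomorphic_on (\<lambda>x. h (g x)) A D"
  unfolding separately_holomorphic_on_def
proof (intro conjI ballI)
  show "continuous_on (A \<times> D) (\<lambda>x. h (g x))"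
    by (rule continuous_on_compose2[OF holomorphic_on_imp_continuous_on[OF h(1)]])
       (use g h in \<open>auto dest: separately_holomorphic_onD\<close>)
  show "(\<lambda>z. h (g (z, w))) holomorphic_on A" if "w \<in> D" for w
    using holomorphic_on_compose_gen[OF separately_holomorphic_onD(2)[OF g that] h(1)] h(2) that
    by (auto simp: o_def image_subset_iff)
  show "(\<lambda>w. h (g (z, w))) holomorphic_on D" if "z \<in> A" for z
    using holomorphic_on_compose_gen[OF separately_holomorphic_onD(3)[OF g that] h(1)] h(2) that
    by (auto simp: o_def image_subset_iff)
qed

lemma separately_holomorphic_on_diff:
  assumes "separately_holomorphic_on g A D" "separately_holomorphic_on h A D"
  shows "separately_holomorphic_on (\<lambda>x. g x - h x) A D"
  using assms unfolding separately_holomorphic_on_def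
  by (auto intro!: continuous_intros holomorphic_intros)

lemma separately_holomorphic_on_mult:
  assumes "separately_holomorphic_on g A D" "separately_holomorphic_on h A D"
  shows "separately_holomorphic_on (\<lambda>x. g x * h x) A D"
  using assms unfolding separately_holomorphic_on_def
  by (auto intro!: continuous_intros holomorphic_intros)

lemma separately_holomorphic_on_const: "separately_holomorphic_on (\<lambda>x. c) A D"
  unfolding separately_holomorphic_on_def by auto

text \<open>
  Holomorphy in the variable that is not differentiated comes from Cauchy's formula, by
  differentiation under the integral.
\<close>

lemma separately_holomorphic_on_deriv:
  assumes A: "open A" and D: "open D" and g: "separately_holomorphic_on g A D"
  shows "separately_holomorphic_on (\<lambda>(z, w). deriv (\<lambda>w. g (z, w)) w) A D"
  unfolding separately_holomorphic_on_def
proof (intro conjI ballI)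
  have "continuous_on (D \<times> A) (\<lambda>x. g (snd x, fst x))"
    by (rule continuous_on_compose2[OF separately_holomorphic_onD(1)[OF g]])
       (auto intro!: continuous_intros)
  then have "continuous_on (D \<times> A) (\<lambda>(w, z). deriv (\<lambda>w. g (z, w)) w)"
    using continuous_on_deriv_param[OF D, of A "\<lambda>x. g (snd x, fst x)"]
      separately_holomorphic_onD(3)[OF g] by simp
  then have "continuous_on (A \<times> D) (\<lambda>x. (\<lambda>(w, z). deriv (\<lambda>w. g (z, w)) w) (snd x, fst x))"
    by (rule continuous_on_compose2) (auto intro!: continuous_intros)
  then show "continuous_on (A \<times> D) (\<lambda>(z, w). deriv (\<lambda>w. g (z, w)) w)"
    by (simp add: case_prod_beta)
  show "(\<lambda>w. case (z, w) of (z, w) \<Rightarrow> deriv (\<lambda>w. g (z, w)) w) holomorphic_on D" if "z \<in> A" for z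
    using holomorphic_deriv[OF separately_holomorphic_onD(3)[OF g that] D] by simp
  fix w assume w: "w \<in> D"
  obtain r where r: "r > 0" "cball w r \<subseteq> D"
    using D w open_contains_cball by blast
  have sph: "sphere w r \<subseteq> D" using r sphere_cball by blast
  have "(\<lambda>z. deriv (\<lambda>w. g (z, w)) w) field_differentiable at z" if z: "z \<in> A" for z
  proof -
    obtain e where e: "e > 0" "ball z e \<subseteq> A" using openE[OF A z] by blast
    have "(\<lambda>z. contour_integral (circlepath w r) (\<lambda>u. (\<lambda>x. g x / (snd x - w)^2) (z, u)))
        holomorphic_on ball z e"
    proof (rule holomorphic_circle_integral_param)
      show "continuous_on (ball z e \<times> sphere w r) (\<lambda>x. g x / (snd x - w)^2)"
        using r e sph by (intro continuous_intros continuous_on_subset[OF separately_holomorphic_onD(1)[OF g]]) auto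
      show "(\<lambda>z. (\<lambda>x. g x / (snd x - w)^2) (z, u)) holomorphic_on ball z e" if "u \<in> sphere w r" for u
        using holomorphic_on_subset[OF separately_holomorphic_onD(2)[OF g] e(2), of u] r sph that
        by (auto intro!: holomorphic_intros)
    qed (use r in auto)
    then have "(\<lambda>z. 1 / (2 * of_real pi * \<i>) * contour_integral (circlepath w r) (\<lambda>u. g (z, u) / (u - w)^2))
        holomorphic_on ball z e"
      by (auto intro!: holomorphic_intros)
    moreover have "1 / (2 * of_real pi * \<i>) * contour_integral (circlepath w r) (\<lambda>u. g (x, u) / (u - w)^2) =
        deriv (\<lambda>w. g (x, w)) w" if "x \<in> ball z e" for x
    proof -
      have h: "(\<lambda>w. g (x, w)) holomorphic_on cball w r"
        using holomorphic_on_subset[OF separately_holomorphic_onD(3)[OF g] r(2), of x] that e by blast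
      have "((\<lambda>w. g (x, w)) has_field_derivative (1 / (2 * of_real pi * \<i>) *
        contour_integral (circlepath w r) (\<lambda>u. g (x, u) / (u - w)^2))) (at w)"
        using r holomorphic_on_subset[OF h ball_subset_cball] h
        by (intro Cauchy_derivative_integral_circlepath) (auto intro: holomorphic_on_imp_continuous_on)
      from DERIV_imp_deriv[OF this] show ?thesis by simp
    qed
    ultimately have "(\<lambda>z. deriv (\<lambda>w. g (z, w)) w) holomorphic_on ball z e"
      by (rule holomorphic_transform)
    then show ?thesis using e by (auto intro: holomorphic_on_imp_differentiable_at)
  qed
  then show "(\<lambda>z. case (z, w) of (z, w) \<Rightarrow> deriv (\<lambda>w. g (z, w)) w) holomorphic_on A"
    by (auto simp: holomorphic_on_def intro: field_differentiable_at_within)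
qed

text \<open>
  A maximum principle on the curve \<open>g = 0\<close> near a point that may be singular. Summing \<open>\<phi>\<close> over
  the zeros of \<open>g (z, _)\<close> near \<open>p2\<close>, with multiplicity, gives a holomorphic function of \<open>z\<close>,
  whereas the number of these zeros is a constant \<open>N\<close>. Since \<open>norm \<phi> \<le> 1\<close> at the zeros, the sum is
  bounded by \<open>N\<close>, a value that it attains at \<open>p1\<close>, where \<open>p2\<close> is the only zero. By the maximum
  modulus principle the sum is constantly \<open>N\<close>, and then every summand takes the extreme value 1.
\<close>

lemma zeros_with_extremal_value_persist:
  assumes A: "open A" "p1 \<in> A" and D: "open D" "p2 \<in> D"
    and g: "separately_holomorphic_on g A D" and \<phi>: "separately_holomorphic_on \<phi> A D"
    and p: "g (p1, p2) = 0" "\<phi> (p1, p2) = 1"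
    and isol: "\<forall>\<^sub>F w in at p2. g (p1, w) \<noteq> 0"
    and bound: "\<And>x. x \<in> A \<times> D \<Longrightarrow> g x = 0 \<Longrightarrow> norm (\<phi> x) \<le> 1"
  shows "\<exists>\<delta>>0. \<forall>z\<in>ball p1 \<delta>. \<exists>w\<in>D. g (z, w) = 0 \<and> \<phi> (z, w) = 1"
proof -
  obtain r1 where r1: "r1 > 0" "\<And>w. w \<noteq> p2 \<Longrightarrow> dist w p2 < r1 \<Longrightarrow> g (p1, w) \<noteq> 0"
    using isol by (auto simp: eventually_at)
  obtain r2 where r2: "r2 > 0" "ball p2 r2 \<subseteq> D" using D openE by blast
  define r where "r = min r1 r2 / 3"
  have r: "r > 0" "3 * r \<le> r1" "ball p2 (3*r) \<subseteq> D"
    using r1 r2 by (auto simp: r_def)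
  have isol': "g (p1, w) \<noteq> 0" if "w \<in> cball p2 r" "w \<noteq> p2" for w
    using r1(2)[OF that(2)] that(1) r by (auto simp: dist_commute)
  have sph: "sphere p2 r \<subseteq> D" and bD: "ball p2 r \<subseteq> D"
    using r by (auto simp: subset_iff)
  define W where "W = {x \<in> A \<times> D. g x \<noteq> 0}"
  have "open W"
    using continuous_open_preimage[OF separately_holomorphic_onD(1)[OF g], of "- {0}"] A D
    by (auto simp: W_def open_Times vimage_def Int_def)
  moreover have "{p1} \<times> sphere p2 r \<subseteq> W"
    using A sph isol' r by (force simp: W_def)
  ultimately obtain X where X: "p1 \<in> X" "open X" "X \<times> sphere p2 r \<subseteq> W"
    using Elementary_Topology.tube_lemma[where K = "sphere p2 r" and W = W and ?x0.0 = p1] by auto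
  obtain \<delta> where \<delta>: "\<delta> > 0" "ball p1 \<delta> \<subseteq> X \<inter> A" using X A openE[of "X \<inter> A" p1] by auto
  define Z where "Z = (\<lambda>z. {w \<in> ball p2 r. g (z, w) = 0})"
  \<comment> \<open>\<open>I h z\<close> is the sum of \<open>h\<close> over the zeros of \<open>g (z, _)\<close> in the disc, as a holomorphic expression in \<open>z\<close>.\<close>
  define I where "I = (\<lambda>h z. contour_integral (circlepath p2 r)
     (\<lambda>w. deriv (\<lambda>w. g (z, w)) w * h (z, w) / g (z, w)) / (2 * pi * \<i>))"
  have nz: "g (z, w) \<noteq> 0" if "z \<in> ball p1 \<delta>" "w \<in> sphere p2 r" for z w
  proof -
    have "(z, w) \<in> X \<times> sphere p2 r" using \<delta> that by blast
    then have "(z, w) \<in> W" using X(3) by blast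
    then show ?thesis by (simp add: W_def)
  qed
  have Z: "finite (Z z)" "\<And>w. w \<in> Z z \<Longrightarrow> zorder (\<lambda>w. g (z, w)) w > 0"
    and I: "separately_holomorphic_on h A D \<Longrightarrow>
      I h z = (\<Sum>w\<in>Z z. h (z, w) * of_int (zorder (\<lambda>w. g (z, w)) w))" if z: "z \<in> ball p1 \<delta>" for h z
  proof -
    have zA: "z \<in> A" using z \<delta> by blast
    have hg: "(\<lambda>w. g (z, w)) holomorphic_on ball p2 (3*r)"
      using holomorphic_on_subset[OF separately_holomorphic_onD(3)[OF g zA] r(3)] .
    note AP = argument_principle_circle[where f = "\<lambda>w. g (z, w)", OF r(1) hg]
    show "finite (Z z)" "\<And>w. w \<in> Z z \<Longrightarrow> zorder (\<lambda>w. g (z, w)) w > 0"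
      using AP(1,2)[OF holomorphic_on_const nz[OF z]] by (auto simp: Z_def)
    show "I h z = (\<Sum>w\<in>Z z. h (z, w) * of_int (zorder (\<lambda>w. g (z, w)) w))"
      if h: "separately_holomorphic_on h A D"
      using AP(3)[OF holomorphic_on_subset[OF separately_holomorphic_onD(3)[OF h zA] r(3)] nz[OF z]]
      by (simp add: I_def Z_def)
  qed
  have holI: "I h holomorphic_on ball p1 \<delta>" if h: "separately_holomorphic_on h A D" for h
  proof -
    let ?F = "\<lambda>x. (case x of (z, w) \<Rightarrow> deriv (\<lambda>w. g (z, w)) w) * h x / g x"
    note S = separately_holomorphic_on_subset[OF _ _ sph, of _ A "ball p1 \<delta>"]
    have d: "separately_holomorphic_on (\<lambda>(z, w). deriv (\<lambda>w. g (z, w)) w) A D"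
      using separately_holomorphic_on_deriv[OF A(1) D(1) g] .
    have "(\<lambda>z. contour_integral (circlepath p2 r) (\<lambda>w. ?F (z, w))) holomorphic_on ball p1 \<delta>"
    proof (rule holomorphic_circle_integral_param)
      show "continuous_on (ball p1 \<delta> \<times> sphere p2 r) ?F"
        using \<delta> nz separately_holomorphic_onD(1)[OF S[OF d]] separately_holomorphic_onD(1)[OF S[OF h]]
          separately_holomorphic_onD(1)[OF S[OF g]]
        by (intro continuous_intros) auto
      show "(\<lambda>z. ?F (z, w)) holomorphic_on ball p1 \<delta>" if "w \<in> sphere p2 r" for w
        using \<delta> nz that separately_holomorphic_onD(2)[OF S[OF d]] separately_holomorphic_onD(2)[OF S[OF h]]
          separately_holomorphic_onD(2)[OF S[OF g]]
        by (intro holomorphic_intros) auto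
    qed (use r in auto)
    then show ?thesis unfolding I_def by (auto intro!: holomorphic_intros)
  qed
  define N where "N = (\<lambda>z. \<Sum>w\<in>Z z. zorder (\<lambda>w. g (z, w)) w)"
  have IN: "I (\<lambda>x. 1) z = of_int (N z)" if "z \<in> ball p1 \<delta>" for z
    using I[OF that separately_holomorphic_on_const] by (simp add: N_def)
  \<comment> \<open>The number of zeros is continuous and an integer.\<close>
  have "I (\<lambda>x. 1) constant_on ball p1 \<delta>"
  proof (rule continuous_discrete_range_constant)
    show "continuous_on (ball p1 \<delta>) (I (\<lambda>x. 1))"
      using holI[OF separately_holomorphic_on_const] by (rule holomorphic_on_imp_continuous_on)
    show "\<exists>e>0. \<forall>y. y \<in> ball p1 \<delta> \<and> I (\<lambda>x. 1) y \<noteq> I (\<lambda>x. 1) x \<longrightarrow> e \<le> norm (I (\<lambda>x. 1) y - I (\<lambda>x. 1) x)"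
      if "x \<in> ball p1 \<delta>" for x
    proof (intro exI[of _ 1] conjI allI impI)
      fix y assume y: "y \<in> ball p1 \<delta> \<and> I (\<lambda>x. 1) y \<noteq> I (\<lambda>x. 1) x"
      then have "N y \<noteq> N x" using IN that by auto
      then have "1 \<le> real_of_int \<bar>N y - N x\<bar>" by linarith
      also have "\<dots> = norm (of_int (N y - N x) :: complex)" by (simp only: norm_of_int of_int_abs)
      finally show "1 \<le> norm (I (\<lambda>x. 1) y - I (\<lambda>x. 1) x)" using IN y that by simp
    qed auto
  qed auto
  then have "I (\<lambda>x. 1) z = I (\<lambda>x. 1) p1" if "z \<in> ball p1 \<delta>" for z
    using that \<delta> unfolding constant_on_def by (metis centre_in_ball)
  then have N: "N z = N p1" if "z \<in> ball p1 \<delta>" for z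
    using IN that \<delta> by (metis centre_in_ball of_int_eq_iff)
  have p1: "p1 \<in> ball p1 \<delta>" using \<delta> by simp
  have Zp: "Z p1 = {p2}"
    using isol'[OF subsetD[OF ball_subset_cball]] p r by (auto simp: Z_def)
  have Ip: "I \<phi> p1 = of_int (N p1)" using I[OF p1 \<phi>] p by (simp add: N_def Zp)
  have Npos: "N p1 > 0" using Z(2)[OF p1] by (simp add: N_def Zp)
  have inAD: "(z, w) \<in> A \<times> D" if "z \<in> ball p1 \<delta>" "w \<in> Z z" for z w
    using that \<delta> bD by (auto simp: Z_def)
  have Ibd: "norm (I \<phi> z) \<le> norm (I \<phi> p1)" if z: "z \<in> ball p1 \<delta>" for z
  proof -
    have "norm (I \<phi> z) \<le> (\<Sum>w\<in>Z z. norm (\<phi> (z, w) * of_int (zorder (\<lambda>w. g (z, w)) w)))"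
      unfolding I[OF z \<phi>] by (rule norm_sum)
    also have "\<dots> \<le> (\<Sum>w\<in>Z z. of_int (zorder (\<lambda>w. g (z, w)) w))"
    proof (rule sum_mono)
      fix w assume w: "w \<in> Z z"
      have "norm (\<phi> (z, w)) \<le> 1" using bound[OF inAD[OF z w]] w by (simp add: Z_def)
      then have "norm (\<phi> (z, w)) * real_of_int (zorder (\<lambda>w. g (z, w)) w) \<le> 1 * real_of_int (zorder (\<lambda>w. g (z, w)) w)"
        using Z(2)[OF z w] by (intro mult_right_mono) auto
      then show "norm (\<phi> (z, w) * of_int (zorder (\<lambda>w. g (z, w)) w)) \<le> of_int (zorder (\<lambda>w. g (z, w)) w)"
        using Z(2)[OF z w] by (simp add: norm_mult)
    qed
    also have "\<dots> = of_int (N p1)" using N[OF z] by (simp add: N_def flip: of_int_sum)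
    also have "\<dots> = norm (I \<phi> p1)" using Npos by (simp add: Ip)
    finally show ?thesis .
  qed
  have "I \<phi> constant_on ball p1 \<delta>"
    by (rule maximum_modulus_principle[OF holI[OF \<phi>], of "ball p1 \<delta>" p1]) (use Ibd p1 in auto)
  then have Iconst: "I \<phi> z = of_int (N p1)" if "z \<in> ball p1 \<delta>" for z
    using that Ip p1 unfolding constant_on_def by metis
  show ?thesis
  proof (intro exI[of _ \<delta>] conjI \<delta>(1) ballI)
    fix z assume z: "z \<in> ball p1 \<delta>"
    have nonneg: "0 \<le> (1 - Re (\<phi> (z, w))) * of_int (zorder (\<lambda>w. g (z, w)) w)" if w: "w \<in> Z z" for w
    proof -
      have "Re (\<phi> (z, w)) \<le> 1"
        using bound[OF inAD[OF z w]] w complex_Re_le_cmod[of "\<phi> (z, w)"] by (simp add: Z_def)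
      then show ?thesis using Z(2)[OF z w] by simp
    qed
    \<comment> \<open>Equality in the triangle inequality: a sum of nonnegative terms that vanishes.\<close>
    have "(\<Sum>w\<in>Z z. (1 - Re (\<phi> (z, w))) * of_int (zorder (\<lambda>w. g (z, w)) w)) =
        of_int (N z) - Re (I \<phi> z)"
      using I[OF z \<phi>] by (simp add: N_def left_diff_distrib sum_subtractf)
    also have "\<dots> = 0" using Iconst[OF z] N[OF z] by simp
    finally have "\<forall>w\<in>Z z. (1 - Re (\<phi> (z, w))) * of_int (zorder (\<lambda>w. g (z, w)) w) = 0"
      by (simp only: sum_nonneg_eq_0_iff[OF Z(1)[OF z] nonneg])
    moreover obtain w where w': "w \<in> Z z" 
      using N[OF z] Npos by (cases "Z z = {}") (auto simp: N_def)
    ultimately have w: "w \<in> Z z" "Re (\<phi> (z, w)) = 1"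
      using Z(2)[OF z w'] by auto
    have "norm (\<phi> (z, w)) \<le> 1" using bound[OF inAD[OF z w(1)]] w by (simp add: Z_def)
    then have "(norm (\<phi> (z, w)))\<^sup>2 \<le> 1" by (simp add: power_le_one)
    then have "Im (\<phi> (z, w)) = 0" using w(2) by (simp add: cmod_power2)
    then show "\<exists>w\<in>D. g (z, w) = 0 \<and> \<phi> (z, w) = 1"
      using w bD by (intro bexI[of _ w]) (auto simp: Z_def complex_eq_iff)
  qed
qed

section \<open>Level sets on which a function has compact vertical strips\<close>

text \<open>
  A nearest point \<open>s\<close> to a point \<open>b\<close> of the complement need not be the only one. It becomes the
  only one when \<open>b\<close> is replaced by the midpoint of \<open>b\<close> and \<open>s\<close>: the disc around the midpoint through
  \<open>s\<close> touches the larger disc from inside. The proof is the parallelogram identity.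
\<close>

lemma closed_set_touching_disc:
  fixes S :: "complex set"
  assumes "closed S" "S \<noteq> {}" "S \<noteq> UNIV"
  shows "\<exists>s\<in>S. \<exists>c. c \<noteq> s \<and> (\<forall>v\<in>S. dist v c \<le> dist s c \<longrightarrow> v = s)"
proof -
  obtain b where b: "b \<notin> S" using assms by blast
  define s where "s = closest_point S b"
  define c where "c = (b + s) / 2"
  have s: "s \<in> S" "\<And>v. v \<in> S \<Longrightarrow> dist b s \<le> dist b v"
    using closest_point_exists[OF assms(1,2)] by (auto simp: s_def)
  have "b \<noteq> s" using b s by blast
  moreover have c: "b = c + (c - s)" by (simp add: c_def)
  ultimately have "c \<noteq> s" by auto
  moreover have "v = s" if v: "v \<in> S" "dist v c \<le> dist s c" for v
  proof -
    define p where "p = v - c"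
    define q where "q = c - s"
    have le: "norm p \<le> norm q" using v(2) by (simp add: p_def q_def dist_norm norm_minus_commute)
    have "p - q = v - b" "2 * q = b - s" by (simp_all add: p_def q_def c_def field_simps)
    then have "2 * norm q \<le> norm (p - q)"
      using s(2)[OF v(1)] norm_mult[of 2 q] by (simp add: dist_norm norm_minus_commute)
    then have "(2 * norm q)^2 \<le> (norm (p - q))^2" by (intro power_mono) auto
    then have "4 * (norm q)^2 \<le> (norm (p - q))^2" by (simp add: power_mult_distrib)
    moreover have "(norm (p + q))^2 + (norm (p - q))^2 = 2 * (norm p)^2 + 2 * (norm q)^2"
      by (simp add: power2_norm_eq_inner inner_simps inner_commute)
    moreover have "(norm p)^2 \<le> (norm q)^2" using le by (intro power_mono) auto
    ultimately have "(norm (p + q))^2 \<le> 0" by linarith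
    then have "p + q = 0" by simp
    then show "v = s" by (simp add: p_def q_def)
  qed
  ultimately show ?thesis using s(1) by blast
qed

lemma compact_open_imp_empty:
  fixes S :: "'a::euclidean_space set"
  assumes "compact S" "open S"
  shows "S = {}"
  using assms clopen[of S] not_compact_UNIV compact_imp_closed by metis

text \<open>
  The core of the argument. If the level set \<open>X\<close> were nonempty, the image \<open>S\<close> of \<open>q\<close> on \<open>X\<close> would
  be closed, and it would not be the whole plane because it is bounded along the imaginary axis.
  So some disc touches \<open>S\<close> from outside in a single point \<open>s\<close>, and a fractional linear \<open>\<phi>\<close> with pole at
  the centre of the disc maps \<open>S\<close> into the closed unit disc and only \<open>s\<close> to 1. By the maximum
  principle the fibre \<open>\<Phi>\<close> of \<open>q\<close> over \<open>s\<close> in \<open>X\<close> then projects onto an open set of first coordinates.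
  But \<open>\<Phi>\<close> is compact, and no nonempty subset of the plane is compact and open.
\<close>

lemma level_set_empty:
  assumes D: "open D" "connected D" "D \<noteq> {}"
    and g: "separately_holomorphic_on g UNIV D" and q: "separately_holomorphic_on q UNIV D"
    and proper: "\<And>B. compact {x \<in> UNIV \<times> D. g x = a \<and> \<bar>Re (q x)\<bar> \<le> B}"
  shows "a \<notin> g ` (UNIV \<times> D)"
proof
  assume a: "a \<in> g ` (UNIV \<times> D)"
  define X where "X = {x \<in> UNIV \<times> D. g x = a}"
  define K where "K = (\<lambda>B. {x \<in> X. \<bar>Re (q x)\<bar> \<le> B})"
  have K: "compact (K B)" for B using proper[of B] by (simp add: K_def X_def conj_assoc)
  have KX: "K B \<subseteq> UNIV \<times> D" for B by (auto simp: K_def X_def)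
  have contq: "continuous_on (K B) q" for B
    using continuous_on_subset[OF separately_holomorphic_onD(1)[OF q] KX] .
  define S where "S = q ` X"
  have "closed S"
    unfolding closed_sequential_limits
  proof (intro allI impI)
    show "l \<in> S" if "(\<forall>n. f n \<in> S) \<and> f \<longlonglongrightarrow> l" for f l
    proof -
      have "bounded (range f)" using that convergent_imp_bounded by blast
      then obtain B where B: "\<And>n. norm (f n) \<le> B" by (auto simp: bounded_iff)
      have "f n \<in> q ` K B" for n
      proof -
        have "f n \<in> q ` X" using that by (simp add: S_def)
        then obtain x where "x \<in> X" "f n = q x" by blast
        then show ?thesis using B[of n] abs_Re_le_cmod[of "q x"] by (auto simp: K_def)
      qed
      moreover have "closed (q ` K B)"
        using compact_continuous_image[OF contq K] compact_imp_closed by blast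
      ultimately have "l \<in> q ` K B" using that closed_sequentially by blast
      then show ?thesis by (auto simp: S_def K_def)
    qed
  qed
  moreover have "S \<noteq> {}" using a by (auto simp: S_def X_def)
  moreover have "S \<noteq> UNIV"
  proof
    assume SU: "S = UNIV"
    have "bounded (q ` K 0)" using compact_continuous_image[OF contq K] compact_imp_bounded by blast
    then obtain B where B: "\<And>x. x \<in> K 0 \<Longrightarrow> norm (q x) \<le> B" by (auto simp: bounded_iff)
    \<comment> \<open>On \<open>K 0\<close> the values of \<open>q\<close> are the purely imaginary values on \<open>X\<close>.\<close>
    have "Complex 0 (\<bar>B\<bar> + 1) \<in> S" using SU by simp
    then obtain x where x: "x \<in> X" "q x = Complex 0 (\<bar>B\<bar> + 1)" by (auto simp: S_def)
    then have "norm (q x) \<le> B" by (intro B) (auto simp: K_def)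
    then show False using abs_Im_le_cmod[of "q x"] x(2) by simp
  qed
  ultimately have "\<exists>s\<in>S. \<exists>c. c \<noteq> s \<and> (\<forall>v\<in>S. dist v c \<le> dist s c \<longrightarrow> v = s)"
    by (rule closed_set_touching_disc)
  then obtain c s where cs: "s \<in> S" "c \<noteq> s" "\<And>v. v \<in> S \<Longrightarrow> dist v c \<le> dist s c \<Longrightarrow> v = s"
    by blast
  define \<phi> where "\<phi> = (\<lambda>v. (s - c) / (v - c))"
  have cS: "v \<noteq> c" if "v \<in> S" for v using cs that by (metis dist_self zero_le_dist)
  have \<phi>S: "norm (\<phi> v) \<le> 1" if "v \<in> S" for v
  proof (cases "v = s")
    case False
    then have "dist s c < dist v c" using cs(3)[OF that] by linarith
    then show ?thesis by (simp add: \<phi>_def norm_divide dist_norm divide_le_eq)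
  qed (use cs in \<open>simp add: \<phi>_def\<close>)
  have \<phi>s: "\<phi> s = 1" using cs(2) by (simp add: \<phi>_def)
  have \<phi>1: "v = s" if "\<phi> v = 1" for v
    using that cs(2) by (cases "v = c") (auto simp: \<phi>_def)
  have hol\<phi>: "\<phi> holomorphic_on - {c}" unfolding \<phi>_def by (intro holomorphic_intros) auto
  define \<Phi> where "\<Phi> = {x \<in> X. q x = s}"
  have \<Phi>eq: "\<Phi> = K \<bar>Re s\<bar> \<inter> (K \<bar>Re s\<bar> \<inter> q -` {s})"
    by (auto simp: \<Phi>_def K_def)
  have "compact \<Phi>"
    unfolding \<Phi>eq
    by (intro compact_Int_closed K continuous_closed_preimage contq compact_imp_closed) auto
  have \<Phi>ne: "\<Phi> \<noteq> {}" using cs(1) by (auto simp: S_def \<Phi>_def)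
  have "compact (fst ` \<Phi>)"
    using \<open>compact \<Phi>\<close> by (auto intro!: compact_continuous_image continuous_intros)
  have "open (fst ` \<Phi>)"
    unfolding open_contains_ball
  proof
    fix p1 assume "p1 \<in> fst ` \<Phi>"
    then obtain p2 where p: "p2 \<in> D" "g (p1, p2) = a" "q (p1, p2) = s"
      by (auto simp: \<Phi>_def X_def)
    show "\<exists>e>0. ball p1 e \<subseteq> fst ` \<Phi>"
    \<comment> \<open>The vertical slice through the point either lies in \<open>X\<close>, and then in the fibre, or it meets \<open>X\<close> there in an isolated point.\<close>
    proof (cases "\<forall>w\<in>D. g (p1, w) = a")
      case True
      have inS: "q (p1, w) \<in> S" if "w \<in> D" for w using True that by (auto simp: S_def X_def)
      have "(\<lambda>w. \<phi> (q (p1, w))) holomorphic_on D"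
        using holomorphic_on_compose_gen[OF separately_holomorphic_onD(3)[OF q] hol\<phi>, of p1] cS inS
        by (auto simp: o_def)
      then have "(\<lambda>w. \<phi> (q (p1, w))) constant_on D"
        by (rule maximum_modulus_principle[OF _ D(1,2,1) subset_refl p(1)])
           (use \<phi>S[OF inS] p \<phi>s in auto)
      then have "\<phi> (q (p1, w)) = 1" if "w \<in> D" for w
        using that p \<phi>s unfolding constant_on_def by metis
      then have "(p1, w) \<in> \<Phi>" if "w \<in> D" for w
        using that True \<phi>1[of "q (p1, w)"] by (simp add: \<Phi>_def X_def)
      then have "D \<subseteq> snd ` (\<Phi> \<inter> {p1} \<times> UNIV)" by force
      moreover have "snd ` (\<Phi> \<inter> {p1} \<times> UNIV) \<subseteq> D" by (auto simp: \<Phi>_def X_def)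
      ultimately have "D = snd ` (\<Phi> \<inter> {p1} \<times> UNIV)" by blast
      moreover have "compact (snd ` (\<Phi> \<inter> {p1} \<times> UNIV))"
        using \<open>compact \<Phi>\<close>
        by (intro compact_continuous_image continuous_intros compact_Int_closed closed_Times) auto
      ultimately have False using compact_open_imp_empty[OF _ D(1)] D(3) by simp
      then show ?thesis ..
    next
      case False
      then obtain w0 where w0: "w0 \<in> D" "g (p1, w0) - a \<noteq> 0" by auto
      have hg: "(\<lambda>w. g (p1, w) - a) holomorphic_on D"
        using separately_holomorphic_onD(3)[OF g] by (auto intro!: holomorphic_intros)
      have isol: "\<forall>\<^sub>F w in at p2. g (p1, w) - a \<noteq> 0"
        using non_zero_neighbour_alt[OF hg D(1,2) p(1) w0] by (rule eventually_mono) auto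
      have "open {x \<in> UNIV \<times> D. q x \<noteq> c}"
        using continuous_open_preimage[OF separately_holomorphic_onD(1)[OF q], of "- {c}"] D(1)
        by (auto simp: open_Times vimage_def Int_def)
      then obtain A B where AB: "open A" "open B" "(p1, p2) \<in> A \<times> B" "A \<times> B \<subseteq> {x \<in> UNIV \<times> D. q x \<noteq> c}"
        using p cS[OF cs(1)] open_prod_elim[of "{x \<in> UNIV \<times> D. q x \<noteq> c}" "(p1, p2)"] by auto
      have "B \<subseteq> D" using AB by auto
      have q': "separately_holomorphic_on q A B" and g': "separately_holomorphic_on g A B"
        using separately_holomorphic_on_subset[OF _ _ \<open>B \<subseteq> D\<close>] q g by auto
      have ga: "separately_holomorphic_on (\<lambda>x. g x - a) A B"
        using separately_holomorphic_on_diff[OF g' separately_holomorphic_on_const] .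
      have \<phi>q: "separately_holomorphic_on (\<lambda>x. \<phi> (q x)) A B"
        by (rule separately_holomorphic_on_compose[OF q' hol\<phi>]) (use AB in auto)
      have bound: "norm (\<phi> (q x)) \<le> 1" if "x \<in> A \<times> B" "g x - a = 0" for x
        using that \<open>B \<subseteq> D\<close> by (intro \<phi>S) (auto simp: S_def X_def)
      have "\<exists>\<delta>>0. \<forall>z\<in>ball p1 \<delta>. \<exists>w\<in>B. g (z, w) - a = 0 \<and> \<phi> (q (z, w)) = 1"
        by (rule zeros_with_extremal_value_persist[OF AB(1) _ AB(2) _ ga \<phi>q _ _ isol bound])
           (use AB(3) p \<phi>s in auto)
      then obtain \<delta> where \<delta>: "\<delta> > 0"
        "\<And>z. z \<in> ball p1 \<delta> \<Longrightarrow> \<exists>w\<in>B. g (z, w) - a = 0 \<and> \<phi> (q (z, w)) = 1"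
        by blast
      have "z \<in> fst ` \<Phi>" if z: "z \<in> ball p1 \<delta>" for z
      proof -
        obtain w where "w \<in> B" "g (z, w) - a = 0" "\<phi> (q (z, w)) = 1" using \<delta>(2)[OF z] by blast
        then have "(z, w) \<in> \<Phi>" using \<open>B \<subseteq> D\<close> \<phi>1 by (auto simp: \<Phi>_def X_def)
        then show ?thesis by force
      qed
      then show ?thesis using \<delta>(1) by blast
    qed
  qed
  then show False using compact_open_imp_empty[OF \<open>compact (fst ` \<Phi>)\<close>] \<Phi>ne by simp
qed

section \<open>Logarithms\<close>

text \<open>
  Near \<open>z\<close>, the continuous logarithm is the principal one applied to \<open>f x / f z\<close>, up to a constant:
  by continuity the imaginary part of \<open>L x - L z\<close> stays below \<open>pi\<close> in modulus.
\<close>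

lemma holomorphic_on_continuous_log:
  assumes S: "open S" and f: "f holomorphic_on S" and L: "continuous_on S L"
    and fL: "\<And>z. z \<in> S \<Longrightarrow> f z = exp (L z)"
  shows "L holomorphic_on S"
proof -
  have "L field_differentiable at z" if z: "z \<in> S" for z
  proof -
    have "isCont L z" using L S z continuous_on_eq_continuous_at by blast
    then obtain d where d: "d > 0" "\<And>x. dist x z < d \<Longrightarrow> dist (L x) (L z) < pi"
      using pi_gt_zero unfolding continuous_at_eps_delta by blast
    obtain e where e: "e > 0" "ball z e \<subseteq> S" using openE[OF S z] by blast
    define r where "r = min d e"
    have r: "r > 0" "ball z r \<subseteq> S" using d e by (auto simp: r_def)
    have im: "\<bar>Im (L x - L z)\<bar> < pi" if "x \<in> ball z r" for x
      using d(2)[of x] that abs_Im_le_cmod[of "L x - L z"] by (simp add: r_def dist_norm norm_minus_commute)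
    have quot: "f x / f z = exp (L x - L z)" if "x \<in> ball z r" for x
      using fL that r z by (auto simp: exp_diff)
    have Ln: "Ln (f x / f z) = L x - L z" if "x \<in> ball z r" for x
      unfolding quot[OF that] using im[OF that] by (intro Ln_exp) (auto simp: abs_if split: if_splits)
    have "f x / f z \<notin> \<real>\<^sub>\<le>\<^sub>0" if "x \<in> ball z r" for x
    proof
      assume "f x / f z \<in> \<real>\<^sub>\<le>\<^sub>0"
      moreover have "f x / f z \<noteq> 0" using quot[OF that] by simp
      ultimately have "Im (Ln (f x / f z)) = pi"
        by (auto simp: Im_Ln_eq_pi complex_nonpos_Reals_iff complex_eq_iff less_le)
      then show False using Ln[OF that] im[OF that] by simp
    qed
    then have "(\<lambda>x. L z + Ln (f x / f z)) holomorphic_on ball z r"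
      using holomorphic_on_subset[OF f r(2)] fL[OF z] by (intro holomorphic_intros) auto
    then have "L holomorphic_on ball z r"
      by (rule holomorphic_transform) (use Ln in auto)
    then show ?thesis using r by (auto intro: holomorphic_on_imp_differentiable_at)
  qed
  then show ?thesis by (auto simp: holomorphic_on_def intro: field_differentiable_at_within)
qed

lemma separately_holomorphic_log:
  assumes h: "separately_holomorphic_on h UNIV UNIV" and nz: "\<And>x. h x \<noteq> 0"
  obtains L where "separately_holomorphic_on L UNIV UNIV" "\<And>x. h x = exp (L x)"
proof -
  have "continuous_on UNIV h" using separately_holomorphic_onD(1)[OF h] by simp
  then obtain L where L: "continuous_on UNIV L" "\<And>x. h x = exp (L x)"
    using continuous_logarithm_on_contractible[of UNIV h] nz by (auto simp: contractible_UNIV)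
  have "(\<lambda>z. L (z, w)) holomorphic_on UNIV" for w
    by (rule holomorphic_on_continuous_log[OF _ separately_holomorphic_onD(2)[OF h, of w]])
       (use L(2) in \<open>auto intro!: continuous_on_compose2[OF L(1)] continuous_intros\<close>)
  moreover have "(\<lambda>w. L (z, w)) holomorphic_on UNIV" for z
    by (rule holomorphic_on_continuous_log[OF _ separately_holomorphic_onD(3)[OF h, of z]])
       (use L(2) in \<open>auto intro!: continuous_on_compose2[OF L(1)] continuous_intros\<close>)
  ultimately have "separately_holomorphic_on L UNIV UNIV"
    using L(1) by (simp add: separately_holomorphic_on_def)
  then show thesis using that L(2) by blast
qed

lemma separately_holomorphic_on_reparam:
  assumes Q: "separately_holomorphic_on Q A D" and l: "l holomorphic_on E" "l ` E \<subseteq> D"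
  shows "separately_holomorphic_on (\<lambda>x. Q (fst x, l (snd x))) A E"
  unfolding separately_holomorphic_on_def
proof (intro conjI ballI)
  have "continuous_on (A \<times> E) (\<lambda>x. l (snd x))"
    by (rule continuous_on_compose2[OF holomorphic_on_imp_continuous_on[OF l(1)]])
       (auto intro!: continuous_intros)
  then have "continuous_on (A \<times> E) (\<lambda>x. (fst x, l (snd x)))" by (intro continuous_intros)
  then show "continuous_on (A \<times> E) (\<lambda>x. Q (fst x, l (snd x)))"
    by (rule continuous_on_compose2[OF separately_holomorphic_onD(1)[OF Q]]) (use l(2) in auto)
  show "(\<lambda>z. Q (fst (z, w), l (snd (z, w)))) holomorphic_on A" if "w \<in> E" for w
    using separately_holomorphic_onD(2)[OF Q, of "l w"] l(2) that by auto
  show "(\<lambda>w. Q (fst (z, w), l (snd (z, w)))) holomorphic_on E" if "z \<in> A" for z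
    using holomorphic_on_compose_gen[OF l(1) separately_holomorphic_onD(3)[OF Q that] l(2)]
    by (simp add: o_def)
qed

lemma separately_holomorphic_on_cong:
  assumes "separately_holomorphic_on g A D" "\<And>x. x \<in> A \<times> D \<Longrightarrow> g x = h x"
  shows "separately_holomorphic_on h A D"
proof -
  have "continuous_on (A \<times> D) h"
    using continuous_on_eq[OF separately_holomorphic_onD(1)[OF assms(1)] assms(2)] by blast
  moreover have "(\<lambda>z. h (z, w)) holomorphic_on A" if "w \<in> D" for w
    by (rule holomorphic_transform[OF separately_holomorphic_onD(2)[OF assms(1) that]])
       (use assms(2) that in auto)
  moreover have "(\<lambda>w. h (z, w)) holomorphic_on D" if "z \<in> A" for z
    by (rule holomorphic_transform[OF separately_holomorphic_onD(3)[OF assms(1) that]])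
       (use assms(2) that in auto)
  ultimately show ?thesis by (simp add: separately_holomorphic_on_def)
qed

text \<open>
  It suffices to localise in the second variable, as only logarithms of that variable have to
  be glued from several branches.
\<close>

lemma separately_holomorphic_on_local:
  assumes A: "open A" and loc: "\<And>w. w \<in> D \<Longrightarrow> \<exists>E. open E \<and> w \<in> E \<and> separately_holomorphic_on g A E"
  shows "separately_holomorphic_on g A D"
  unfolding separately_holomorphic_on_def
proof (intro conjI ballI)
  show "continuous_on (A \<times> D) g"
  proof (rule continuous_at_imp_continuous_on, rule ballI)
    fix x assume x: "x \<in> A \<times> D"
    then obtain E where E: "open E" "snd x \<in> E" "separately_holomorphic_on g A E"
      using loc[of "snd x"] by auto
    then have "x \<in> A \<times> E" using x by (auto simp: mem_Times_iff)
    then show "isCont g x"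
      using separately_holomorphic_onD(1)[OF E(3)] open_Times[OF A E(1)]
      using continuous_on_eq_continuous_at by blast
  qed
  show "(\<lambda>z. g (z, w)) holomorphic_on A" if "w \<in> D" for w
    using loc[OF that] separately_holomorphic_onD(2) by blast
  show "(\<lambda>w. g (z, w)) holomorphic_on D" if z: "z \<in> A" for z
    unfolding holomorphic_on_def
  proof
    fix w assume "w \<in> D"
    then obtain E where E: "open E" "w \<in> E" "separately_holomorphic_on g A E" using loc by blast
    then show "(\<lambda>w. g (z, w)) field_differentiable at w within D"
      using separately_holomorphic_onD(3)[OF E(3) z] holomorphic_on_imp_differentiable_at
        field_differentiable_at_within by blast
  qed
qed

text \<open>
  The quotient is \<open>Q (z, Ln w)\<close>. Although \<open>Ln\<close> jumps across the negative axis, periodicity allows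
  the use of any other branch of the logarithm, and near each point some branch is holomorphic.
\<close>

lemma periodic_descends_to_Cstar:
  assumes Q: "separately_holomorphic_on Q UNIV UNIV"
    and per: "\<And>z w. Q (z, w + 2 * of_real pi * \<i>) = Q (z, w)"
  obtains q where "separately_holomorphic_on q UNIV Cstar" "\<And>z w. q (z, exp w) = Q (z, w)"
proof -
  have pern: "Q (z, w + of_nat k * (2 * of_real pi * \<i>)) = Q (z, w)" for z w k
  proof (induction k)
    case (Suc k)
    show ?case using per[of z "w + of_nat k * (2 * of_real pi * \<i>)"] Suc by (simp add: algebra_simps)
  qed simp
  have peri: "Q (z, w + of_int k * (2 * of_real pi * \<i>)) = Q (z, w)" for z w k
  proof (cases "k \<ge> 0")
    case True
    then show ?thesis using pern[of z w "nat k"] by simp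
  next
    case False
    then show ?thesis using pern[of z "w + of_int k * (2 * of_real pi * \<i>)" "nat (-k)"] by simp
  qed
  have Qexp: "Q (z, v) = Q (z, w)" if vw: "exp v = exp w" for z v w
  proof -
    obtain k :: int where "v = w + (of_int (2 * k) * pi) * \<i>"
      using vw unfolding exp_eq by blast
    then show ?thesis using peri[of z w k] by (simp add: algebra_simps)
  qed
  define q where "q = (\<lambda>x. Q (fst x, Ln (snd x)))"
  have "separately_holomorphic_on q UNIV Cstar"
  proof (rule separately_holomorphic_on_local)
    fix a assume a: "a \<in> Cstar"
    define E where "E = (\<lambda>w. w / a) -` (- \<real>\<^sub>\<le>\<^sub>0)"
    \<comment> \<open>A branch of the logarithm that is holomorphic near \<open>a\<close>.\<close>
    define l where "l = (\<lambda>w. Ln (w / a) + Ln a)"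
    have "open E" unfolding E_def
      using a by (intro open_vimage continuous_intros) auto
    moreover have "a \<in> E" using a by (simp add: E_def)
    moreover have "l holomorphic_on E"
      unfolding l_def using a by (intro holomorphic_intros) (auto simp: E_def)
    then have "separately_holomorphic_on (\<lambda>x. Q (fst x, l (snd x))) UNIV E"
      by (rule separately_holomorphic_on_reparam[OF Q]) auto
    then have "separately_holomorphic_on q UNIV E"
    proof (rule separately_holomorphic_on_cong)
      fix x :: "complex \<times> complex" assume "x \<in> UNIV \<times> E"
      then have "snd x \<noteq> 0" by (auto simp: E_def)
      then have "exp (l (snd x)) = exp (Ln (snd x))" using a by (simp add: l_def exp_add)
      then show "Q (fst x, l (snd x)) = q x" unfolding q_def by (rule Qexp)
    qed
    ultimately show "\<exists>E. open E \<and> a \<in> E \<and> separately_holomorphic_on q UNIV E" by blast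
  qed auto
  moreover have "q (z, exp w) = Q (z, w)" for z w
    unfolding q_def by (simp, rule Qexp) simp
  ultimately show thesis using that by blast
qed

text \<open>
  The integer \<open>n\<close> is the winding number of \<open>h (z, _)\<close> around the puncture. It exists because the
  increment of the lifted logarithm over one period is continuous with values in a discrete set.
\<close>

lemma log_on_universal_cover:
  assumes h: "separately_holomorphic_on h UNIV Cstar" and nz: "\<And>x. x \<in> UNIV \<times> Cstar \<Longrightarrow> h x \<noteq> 0"
  obtains L n where "separately_holomorphic_on L UNIV UNIV" "\<And>z w. h (z, exp w) = exp (L (z, w))"
    "\<And>z w. L (z, w + 2 * of_real pi * \<i>) = L (z, w) + 2 * of_int n * of_real pi * \<i>"
proof -
  have "separately_holomorphic_on (\<lambda>x. h (fst x, exp (snd x))) UNIV UNIV"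
    by (rule separately_holomorphic_on_reparam[OF h]) (auto intro!: holomorphic_intros)
  then obtain L where L: "separately_holomorphic_on L UNIV UNIV" "\<And>x. h (fst x, exp (snd x)) = exp (L x)"
    using separately_holomorphic_log[of "\<lambda>x. h (fst x, exp (snd x))"] nz by auto
  have hL: "h (z, exp w) = exp (L (z, w))" for z w using L(2)[of "(z, w)"] by simp
  define M where "M = (\<lambda>x. (L (fst x, snd x + 2 * of_real pi * \<i>) - L x) / (2 * of_real pi * \<i>))"
  have M: "\<exists>k. M x = of_int k" for x
  proof -
    have "exp (L (fst x, snd x + 2 * of_real pi * \<i>)) = exp (L x)"
      using L(2)[of "(fst x, snd x + 2 * of_real pi * \<i>)"] L(2)[of x] by (simp add: exp_add)
    then obtain k :: int where "L (fst x, snd x + 2 * of_real pi * \<i>) = L x + (of_int (2 * k) * pi) * \<i>"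
      unfolding exp_eq by blast
    then show ?thesis by (auto simp: M_def)
  qed
  have cL: "continuous_on UNIV L" using separately_holomorphic_onD(1)[OF L(1)] by simp
  have "M constant_on UNIV"
  proof (rule continuous_discrete_range_constant)
    show "continuous_on UNIV M"
      unfolding M_def by (intro continuous_intros continuous_on_compose2[OF cL]) auto
    show "\<exists>e>0. \<forall>y. y \<in> UNIV \<and> M y \<noteq> M x \<longrightarrow> e \<le> norm (M y - M x)" for x
    proof (intro exI[of _ 1] conjI allI impI)
      fix y assume y: "y \<in> UNIV \<and> M y \<noteq> M x"
      obtain k j where kj: "M y = of_int k" "M x = of_int j" using M by metis
      then have "1 \<le> real_of_int \<bar>k - j\<bar>" using y by force
      also have "\<dots> = norm (of_int (k - j) :: complex)" by (simp only: norm_of_int of_int_abs)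
      finally show "1 \<le> norm (M y - M x)" using kj by simp
    qed auto
  qed (simp add: convex_connected)
  then obtain n where n: "M x = of_int n" for x using M unfolding constant_on_def by (metis UNIV_I)
  have "L (z, w + 2 * of_real pi * \<i>) = L (z, w) + 2 * of_int n * of_real pi * \<i>" for z w
    using n[of "(z, w)"] by (simp add: M_def field_simps)
  then show thesis using that L(1) hL by blast
qed

section \<open>Proper holomorphic maps\<close>

text \<open>
  A complex homogeneous real derivative restricts to multiplication by a complex number on each
  coordinate line.
\<close>

lemma holomorphic2_on_imp_separately_holomorphic_on:
  assumes f: "f holomorphic2_on (A \<times> D)" and A: "open A" and D: "open D"
  shows "separately_holomorphic_on (\<lambda>x. fst (f x)) A D" "separately_holomorphic_on (\<lambda>x. snd (f x)) A D"
proof -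
  have c: "continuous_on (A \<times> D) f" using holomorphic2_on_imp_continuous_on[OF f] .
  have diff: "(\<lambda>z. fst (f (z, w))) field_differentiable at z \<and> (\<lambda>z. snd (f (z, w))) field_differentiable at z \<and>
        (\<lambda>w. fst (f (z, w))) field_differentiable at w \<and> (\<lambda>w. snd (f (z, w))) field_differentiable at w"
    if "z \<in> A" "w \<in> D" for z w
  proof -
    have zw: "(z, w) \<in> A \<times> D" using that by simp
    obtain L where "(f has_derivative L) (at (z, w) within A \<times> D)"
      and lin: "\<And>c v w. L (c * v, c * w) = (c * fst (L (v, w)), c * snd (L (v, w)))"
      using f zw unfolding holomorphic2_on_def by blast
    then have L: "(f has_derivative L) (at (z, w))"
      using at_within_open[OF zw open_Times[OF A D]] by simp
    have 1: "((\<lambda>u. f (u, w)) has_derivative (\<lambda>h. L (h, 0))) (at z)"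
      by (rule has_derivative_compose[where f = "\<lambda>u. (u, w)" and x = z and g = f, OF _ L])
         (rule has_derivative_Pair has_derivative_ident has_derivative_const)+
    have 2: "((\<lambda>u. f (z, u)) has_derivative (\<lambda>h. L (0, h))) (at w)"
      by (rule has_derivative_compose[where f = "\<lambda>u. (z, u)" and x = w and g = f, OF _ L])
         (rule has_derivative_Pair has_derivative_ident has_derivative_const)+
    have L1: "L (h, 0) = (h * fst (L (1, 0)), h * snd (L (1, 0)))" for h using lin[of h 1 0] by simp
    have L2: "L (0, h) = (h * fst (L (0, 1)), h * snd (L (0, 1)))" for h using lin[of h 0 1] by simp
    have l1: "(\<lambda>h. fst (L (h, 0))) = (*) (fst (L (1, 0)))" "(\<lambda>h. snd (L (h, 0))) = (*) (snd (L (1, 0)))"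
      by (rule ext, subst L1, simp add: mult.commute)+
    have l2: "(\<lambda>h. fst (L (0, h))) = (*) (fst (L (0, 1)))" "(\<lambda>h. snd (L (0, h))) = (*) (snd (L (0, 1)))"
      by (rule ext, subst L2, simp add: mult.commute)+
    show ?thesis
      using has_derivative_fst[OF 1] has_derivative_snd[OF 1] has_derivative_fst[OF 2] has_derivative_snd[OF 2]
      unfolding l1 l2 field_differentiable_def has_field_derivative_def by blast
  qed
  have "continuous_on (A \<times> D) (\<lambda>x. fst (f x))" "continuous_on (A \<times> D) (\<lambda>x. snd (f x))"
    by (rule continuous_on_fst[OF c] continuous_on_snd[OF c])+
  moreover have "(\<lambda>z. fst (f (z, w))) holomorphic_on A" "(\<lambda>z. snd (f (z, w))) holomorphic_on A"
    if w: "w \<in> D" for w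
    using diff[OF _ w] by (simp_all add: holomorphic_on_def field_differentiable_at_within)
  moreover have "(\<lambda>w. fst (f (z, w))) holomorphic_on D" "(\<lambda>w. snd (f (z, w))) holomorphic_on D"
    if z: "z \<in> A" for z
    using diff[OF z] by (simp_all add: holomorphic_on_def field_differentiable_at_within)
  ultimately show "separately_holomorphic_on (\<lambda>x. fst (f x)) A D"
      "separately_holomorphic_on (\<lambda>x. snd (f x)) A D"
    by (simp_all add: separately_holomorphic_on_def)
qed

text \<open>
  This makes the compactness demanded by the core argument a consequence of properness: the
  part of the level set where \<open>Re q\<close> is bounded only has to be mapped into a compact subset of \<open>V\<close>.
\<close>

lemma proper_holomorphic_level_set_empty:
  assumes D: "open D" "connected D" "D \<noteq> {}"
    and f: "proper_holomorphic (UNIV \<times> D) V f"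
    and g: "separately_holomorphic_on g UNIV D" and q: "separately_holomorphic_on q UNIV D"
    and cpt: "\<And>B. \<exists>K. compact K \<and> K \<subseteq> V \<and> (\<forall>x\<in>UNIV \<times> D. g x = a \<and> \<bar>Re (q x)\<bar> \<le> B \<longrightarrow> f x \<in> K)"
  shows "a \<notin> g ` (UNIV \<times> D)"
proof (rule level_set_empty[OF D g q])
  fix B
  obtain K where K: "compact K" "K \<subseteq> V" "\<And>x. x \<in> UNIV \<times> D \<Longrightarrow> g x = a \<Longrightarrow> \<bar>Re (q x)\<bar> \<le> B \<Longrightarrow> f x \<in> K"
    using cpt[of B] by blast
  define P where "P = {x \<in> UNIV \<times> D. f x \<in> K}"
  have P: "compact P" using f K(1,2) by (simp add: P_def proper_holomorphic_iff)
  have "P \<subseteq> UNIV \<times> D" by (auto simp: P_def)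
  then have "continuous_on P g" "continuous_on P q"
    using separately_holomorphic_onD(1) g q continuous_on_subset by blast+
  then have "continuous_on P (\<lambda>x. (g x, \<bar>Re (q x)\<bar>))" by (intro continuous_intros)
  then have "closed (P \<inter> (\<lambda>x. (g x, \<bar>Re (q x)\<bar>)) -` ({a} \<times> {..B}))"
    by (rule continuous_closed_preimage) (use P in \<open>auto intro: compact_imp_closed closed_Times\<close>)
  then have "compact (P \<inter> (P \<inter> (\<lambda>x. (g x, \<bar>Re (q x)\<bar>)) -` ({a} \<times> {..B})))"
    by (rule compact_Int_closed[OF P])
  moreover have "P \<inter> (P \<inter> (\<lambda>x. (g x, \<bar>Re (q x)\<bar>)) -` ({a} \<times> {..B})) =
      {x \<in> UNIV \<times> D. g x = a \<and> \<bar>Re (q x)\<bar> \<le> B}"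
    using K(3) by (auto simp: P_def)
  ultimately show "compact {x \<in> UNIV \<times> D. g x = a \<and> \<bar>Re (q x)\<bar> \<le> B}" by simp
qed

definition log_annulus :: "real \<Rightarrow> complex set" where
  "log_annulus B = {w. exp (- B) \<le> norm w \<and> norm w \<le> exp B}"

lemma compact_log_annulus: "compact (log_annulus B)"
proof -
  have "log_annulus B = cball 0 (exp B) \<inter> {w. exp (- B) \<le> norm w}" by (auto simp: log_annulus_def)
  moreover have "closed {w::complex. exp (- B) \<le> norm w}"
    by (intro closed_Collect_le continuous_intros)
  ultimately show ?thesis by (simp add: compact_Int_closed)
qed

lemma log_annulus_subset_Cstar: "log_annulus B \<subseteq> Cstar"
  by (auto simp: log_annulus_def)

lemma exp_in_log_annulus: "\<bar>Re v\<bar> \<le> B \<Longrightarrow> exp v \<in> log_annulus B"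
  by (auto simp: log_annulus_def)

text \<open>
  When the second component is \<open>exp q\<close>, a bound on \<open>Re q\<close> confines it to a closed annulus, while the
  unbounded imaginary part of \<open>q\<close> is invisible to \<open>f\<close>. The level sets of the first component
  therefore fall under the core argument.
\<close>

lemma no_proper_with_logarithm:
  assumes D: "open D" "connected D" "D \<noteq> {}"
    and f: "proper_holomorphic (UNIV \<times> D) (W \<times> Cstar) f"
    and q: "separately_holomorphic_on q UNIV D" "\<And>x. x \<in> UNIV \<times> D \<Longrightarrow> snd (f x) = exp (q x)"
  shows False
proof -
  have fV: "f x \<in> W \<times> Cstar" if "x \<in> UNIV \<times> D" for x
    using f that by (auto simp: proper_holomorphic_def)
  have g: "separately_holomorphic_on (\<lambda>x. fst (f x)) UNIV D"
    using f D by (intro holomorphic2_on_imp_separately_holomorphic_on) (auto simp: proper_holomorphic_def)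
  obtain x0 :: "complex \<times> complex" where x0: "x0 \<in> UNIV \<times> D" using D(3) by auto
  have "fst (f x0) \<notin> (\<lambda>x. fst (f x)) ` (UNIV \<times> D)"
  proof (rule proper_holomorphic_level_set_empty[OF D f g q(1)])
    fix B
    show "\<exists>K. compact K \<and> K \<subseteq> W \<times> Cstar \<and>
      (\<forall>x\<in>UNIV \<times> D. fst (f x) = fst (f x0) \<and> \<bar>Re (q x)\<bar> \<le> B \<longrightarrow> f x \<in> K)"
    proof (intro exI[of _ "{fst (f x0)} \<times> log_annulus B"] conjI ballI impI)
      show "compact ({fst (f x0)} \<times> log_annulus B)" by (intro compact_Times compact_log_annulus) auto
      show "{fst (f x0)} \<times> log_annulus B \<subseteq> W \<times> Cstar"
        using fV[OF x0] log_annulus_subset_Cstar by (auto simp: mem_Times_iff)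
      fix x assume "x \<in> UNIV \<times> D" "fst (f x) = fst (f x0) \<and> \<bar>Re (q x)\<bar> \<le> B"
      then show "f x \<in> {fst (f x0)} \<times> log_annulus B"
        using q(2)[of x] exp_in_log_annulus[of "q x" B] by (simp add: mem_Times_iff)
    qed
  qed
  then show False using x0 by blast
qed

lemma no_proper_from_C2:
  assumes f: "proper_holomorphic (UNIV \<times> UNIV) (W \<times> Cstar) f"
  shows False
proof -
  have "separately_holomorphic_on (\<lambda>x. snd (f x)) UNIV UNIV"
    using f by (intro holomorphic2_on_imp_separately_holomorphic_on) (auto simp: proper_holomorphic_def)
  moreover have "snd (f x) \<noteq> 0" for x
  proof -
    have "f x \<in> W \<times> Cstar" using f by (auto simp: proper_holomorphic_def)
    then show ?thesis by (auto simp: mem_Times_iff)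
  qed
  ultimately obtain q where "separately_holomorphic_on q UNIV UNIV" "\<And>x. snd (f x) = exp (q x)"
    using separately_holomorphic_log[of "\<lambda>x. snd (f x)"] by blast
  then show False using no_proper_with_logarithm[OF _ _ _ f, of q] by (simp add: convex_connected)
qed

text \<open>
  Here neither component needs to have a logarithm, but with the winding numbers \<open>m\<close> and \<open>n\<close> of the
  two components the function \<open>(fst f) ^ n / (snd f) ^ m\<close> has winding number 0, hence a
  logarithm \<open>q\<close>. For \<open>n \<noteq> 0\<close>, on a level set of \<open>snd f\<close> a bound on \<open>Re q\<close> bounds the modulus of \<open>fst f\<close>
  from both sides. For \<open>n = 0\<close> the second component itself has a logarithm.
\<close>

lemma no_proper_from_C_times_Cstar:
  assumes f: "proper_holomorphic (UNIV \<times> Cstar) (Cstar \<times> Cstar) f"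
  shows False
proof -
  have D: "open Cstar" "connected Cstar" "Cstar \<noteq> {}"
    using connected_punctured_universe[of "0::complex"] by auto
  have fV: "f x \<in> Cstar \<times> Cstar" if "x \<in> UNIV \<times> Cstar" for x
    using f that by (auto simp: proper_holomorphic_def)
  have nz: "fst (f x) \<noteq> 0" "snd (f x) \<noteq> 0" if "x \<in> UNIV \<times> Cstar" for x
    using fV[OF that] by (auto simp: mem_Times_iff)
  have g: "separately_holomorphic_on (\<lambda>x. fst (f x)) UNIV Cstar" "separately_holomorphic_on (\<lambda>x. snd (f x)) UNIV Cstar"
    using f holomorphic2_on_imp_separately_holomorphic_on[of f UNIV Cstar]
    by (auto simp: proper_holomorphic_def)
  obtain L1 m where L1: "separately_holomorphic_on L1 UNIV UNIV" "\<And>z w. fst (f (z, exp w)) = exp (L1 (z, w))"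
    "\<And>z w. L1 (z, w + 2 * of_real pi * \<i>) = L1 (z, w) + 2 * of_int m * of_real pi * \<i>"
    using log_on_universal_cover[OF g(1) nz(1)] by metis
  obtain L2 n where L2: "separately_holomorphic_on L2 UNIV UNIV" "\<And>z w. snd (f (z, exp w)) = exp (L2 (z, w))"
    "\<And>z w. L2 (z, w + 2 * of_real pi * \<i>) = L2 (z, w) + 2 * of_int n * of_real pi * \<i>"
    using log_on_universal_cover[OF g(2) nz(2)] by metis
  have cover: "\<exists>w. x = (fst x, exp w)" if "x \<in> UNIV \<times> Cstar" for x :: "complex \<times> complex"
    using that exp_Ln[of "snd x"]
    by (intro exI[of _ "Ln (snd x)"]) (simp add: prod_eq_iff mem_Times_iff)
  show False
  proof (cases "n = 0")
    case True
    obtain q where q: "separately_holomorphic_on q UNIV Cstar" "\<And>z w. q (z, exp w) = L2 (z, w)"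
      using periodic_descends_to_Cstar[OF L2(1)] L2(3) True by auto
    have "snd (f x) = exp (q x)" if "x \<in> UNIV \<times> Cstar" for x
      using cover[OF that] L2(2) q(2) by metis
    then show False using no_proper_with_logarithm[OF D f q(1)] by blast
  next
    case False
    \<comment> \<open>The periods of the two terms cancel.\<close>
    define Q where "Q = (\<lambda>x. of_int n * L1 x - of_int m * L2 x)"
    have "separately_holomorphic_on Q UNIV UNIV"
      unfolding Q_def
      by (intro separately_holomorphic_on_diff separately_holomorphic_on_mult
          separately_holomorphic_on_const L1 L2)
    moreover have "Q (z, w + 2 * of_real pi * \<i>) = Q (z, w)" for z w
      unfolding Q_def L1(3) L2(3) by (simp add: algebra_simps)
    ultimately obtain q where q: "separately_holomorphic_on q UNIV Cstar" "\<And>z w. q (z, exp w) = Q (z, w)"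
      using periodic_descends_to_Cstar by metis
    have x0: "(0, 1) \<in> (UNIV \<times> Cstar :: (complex \<times> complex) set)" by simp
    define a where "a = snd (f (0, 1))"
    have a: "a \<noteq> 0" using nz(2)[OF x0] by (simp add: a_def)
    have "a \<notin> (\<lambda>x. snd (f x)) ` (UNIV \<times> Cstar)"
    proof (rule proper_holomorphic_level_set_empty[OF D f g(2) q(1)])
      fix B
      \<comment> \<open>On the level set, \<open>n * ln (norm (fst f)) = Re q + m * ln (norm a)\<close>, and \<open>n\<close> is a nonzero integer.\<close>
      define C where "C = B + \<bar>of_int m * ln (norm a)\<bar>"
      show "\<exists>K. compact K \<and> K \<subseteq> Cstar \<times> Cstar \<and>
        (\<forall>x\<in>UNIV \<times> Cstar. snd (f x) = a \<and> \<bar>Re (q x)\<bar> \<le> B \<longrightarrow> f x \<in> K)"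
      proof (intro exI[of _ "log_annulus C \<times> {a}"] conjI ballI impI)
        show "compact (log_annulus C \<times> {a})" by (intro compact_Times compact_log_annulus) auto
        show "log_annulus C \<times> {a} \<subseteq> Cstar \<times> Cstar" using a log_annulus_subset_Cstar by auto
        fix x assume x: "x \<in> UNIV \<times> Cstar" "snd (f x) = a \<and> \<bar>Re (q x)\<bar> \<le> B"
        obtain w where w: "x = (fst x, exp w)" using cover[OF x(1)] by blast
        have "exp (L2 (fst x, w)) = a" using L2(2)[of "fst x" w] w x(2) by simp
        then have "Re (L2 (fst x, w)) = ln (norm a)" by (metis ln_exp norm_exp_eq_Re)
        moreover have "q x = Q (fst x, w)" using q(2)[of "fst x" w] w by simp
        ultimately have "of_int n * Re (L1 (fst x, w)) = Re (q x) + of_int m * ln (norm a)"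
          by (simp add: Q_def)
        then have "\<bar>of_int n * Re (L1 (fst x, w))\<bar> \<le> C"
          using x(2) unfolding C_def by linarith
        moreover have "1 * \<bar>Re (L1 (fst x, w))\<bar> \<le> \<bar>of_int n\<bar> * \<bar>Re (L1 (fst x, w))\<bar>"
          using False by (intro mult_right_mono) auto
        ultimately have "\<bar>Re (L1 (fst x, w))\<bar> \<le> C" by (simp add: abs_mult)
        then have "fst (f x) \<in> log_annulus C"
          using exp_in_log_annulus L1(2)[of "fst x" w] w by simp
        then show "f x \<in> log_annulus C \<times> {a}" using x(2) by (simp add: mem_Times_iff)
      qed
    qed
    then show False using x0 by (force simp: a_def)
  qed
qed

theorem proposition12:
  shows "(\<nexists>f. proper_holomorphic (UNIV \<times> UNIV) (UNIV \<times> Cstar) f) \<and>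
         (\<nexists>f. proper_holomorphic (UNIV \<times> UNIV) (Cstar \<times> Cstar) f) \<and>
         (\<nexists>f. proper_holomorphic (UNIV \<times> Cstar) (Cstar \<times> Cstar) f)"
  using no_proper_from_C2 no_proper_from_C_times_Cstar by blast

end
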